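(* Let $p\ge 5$ be a prime and $n$ a positive integer. Then $a_0(pn)\equiv a_0(n)\pmod{p^2}$, where the Almkvist–Zudilin numbers are $$a_0(N)=\sum_{k=0}^{\lfloor N/3\rfloor}(-1)^{N-k}\binom{3k}{k}\binom{2k}{k}\binom{N}{3k}\binom{N+k}{k}3^{N-3k}.$$ *)

theory Defs
  imports "HOL-Number_Theory.Number_Theory"
begin

(* Both natural-number subtractions are exact, since 3 * k <= N on the range of summation. *)
definition almkvist_zudilin :: "nat \<Rightarrow> int" where
  "almkvist_zudilin N =
     (\<Sum>k = 0..N div 3. (-1) ^ (N - k) * int ((3 * k) choose k) * int ((2 * k) choose k)
        * int (N choose (3 * k)) * int ((N + k) choose k) * 3 ^ (N - 3 * k))"

end

theory Submission
  imports Defs "HOL-Computational_Algebra.Formal_Power_Series"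
begin

text \<open>
  Split the sum for \<open>a\<^sub>0(p n)\<close> by writing the index as \<open>k = p j + r\<close> with \<open>0 \<le> r < p\<close>.
  If \<open>3 r > p\<close>, both \<open>C(3k,k) C(2k,k)\<close> and \<open>C(p n, 3k)\<close> are divisible by \<open>p\<close>. For \<open>r = 0\<close> the
  binomial coefficients are those of the \<open>j\<close>-th term of \<open>a\<^sub>0(n)\<close> modulo \<open>p\<^sup>2\<close>, but \<open>3\<^sup>N\<close> with
  \<open>N = n - 3j\<close> is replaced by \<open>3\<^sup>p\<^sup>N\<close>. For \<open>0 < 3 r < p\<close> the term is \<open>N/3\<close> times the \<open>j\<close>-th term
  times \<open>(-1)\<^sup>r C(3r,r) C(2r,r) C(p,3r) 3\<^bsup>p-3r\<^esup>\<close>, so everything reduces to showing that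
  these last factors, summed over \<open>1 \<le> r \<le> m = \<lfloor>p/3\<rfloor>\<close>, give \<open>3 - 3\<^sup>p\<close> modulo \<open>p\<^sup>2\<close>.
  Modulo \<open>p\<close> one has \<open>C(3r,r) C(2r,r) = (-27)\<^sup>r C(m,r) C(m+r,r)\<close>, because \<open>-m\<close> and \<open>m+1\<close> are
  \<open>1/3\<close> and \<open>2/3\<close> in some order; the identity
  \<open>\<Sum>\<^sub>r (-1)\<^sup>r C(m,r) C(m+r,r) / r = -2 H\<^sub>m\<close> turns the sum into \<open>2 p H\<^sub>m\<close>, and
  \<open>3\<^sup>p = 3 - 2 p H\<^sub>m\<close> modulo \<open>p\<^sup>2\<close> follows by comparing \<open>\<Prod>\<^sub>k 3k\<close> with
  \<open>\<Prod>\<^sub>k (3k mod p) = (p-1)!\<close> over \<open>0 < k < p\<close>.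
\<close>

subsection \<open>Binomial coefficients modulo a prime and its square\<close>

text \<open>Vandermonde's convolution, with only the terms \<open>i = 0\<close> and
  \<open>i = p\<close> surviving. The modulus \<open>M\<close> is left free so that one induction
  step serves both modulo \<open>p\<close> and modulo \<open>p^2\<close>.\<close>

lemma binomial_add_cong:
  fixes p N k M :: nat
  assumes "p > 0"
    and "\<And>i. 0 < i \<Longrightarrow> i < p \<Longrightarrow> i \<le> k \<Longrightarrow> M dvd (p choose i) * (N choose (k - i))"
  shows "[(p + N) choose k = (N choose k) + (if p \<le> k then N choose (k - p) else 0)] (mod M)"
proof -
  have "[(\<Sum>i\<le>k. (p choose i) * (N choose (k - i))) =
      (\<Sum>i\<le>k. (if i = 0 then N choose k else 0) + (if i = p then N choose (k - p) else 0))] (mod M)"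
  proof (rule cong_sum)
    fix i assume "i \<in> {..k}"
    then show "[(p choose i) * (N choose (k - i)) =
        (if i = 0 then N choose k else 0) + (if i = p then N choose (k - p) else 0)] (mod M)"
      using assms by (cases "i < p") (auto simp: cong_0_iff binomial_eq_0)
  qed
  then show ?thesis
    by (simp add: vandermonde sum.distrib)
qed

text \<open>Adding \<open>p\<close> to the upper index acts modulo \<open>p\<close> like Pascal's
  rule on \<open>a choose b\<close>, which drives the induction on \<open>a\<close>.\<close>

lemma lucas_cong:
  fixes p a b c d :: nat
  assumes p: "prime p" and "c < p" "d < p"
  shows "[(p * a + c) choose (p * b + d) = (a choose b) * (c choose d)] (mod p)"
proof (induction a arbitrary: b)
  case 0
  have "c < p * b + d" if "b > 0"
  proof -
    have "p * 1 \<le> p * b" using that by (intro mult_le_mono2) auto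
    with \<open>c < p\<close> show ?thesis by linarith
  qed
  then show ?case
    by (cases "b = 0") (simp_all add: binomial_eq_0)
next
  case (Suc a)
  have step: "[(p + (p * a + c)) choose (p * b + d) = ((p * a + c) choose (p * b + d)) +
      (if p \<le> p * b + d then (p * a + c) choose (p * b + d - p) else 0)] (mod p)"
    using p by (intro binomial_add_cong dvd_mult2 dvd_choose_prime) (auto simp: prime_gt_0_nat)
  show ?case
  proof (cases b)
    case 0
    with step Suc.IH[of 0] \<open>d < p\<close> show ?thesis
      by (auto simp: add.assoc intro: cong_trans)
  next
    case (Suc b')
    from cong_add[OF Suc.IH[of b] Suc.IH[of b']] step Suc show ?thesis
      by (auto simp: algebra_simps intro: cong_trans)
  qed
qed

text \<open>Lucas with last digit 0 above and \<open>d\<close> below gives the factor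
  \<open>0 choose d\<close>, which vanishes.\<close>

lemma prime_dvd_binomial_mult:
  fixes p a b d :: nat
  assumes p: "prime p" and d: "0 < d" "d < p"
  shows "p dvd ((p * a) choose (p * b + d))"
proof -
  have "[(p * a + 0) choose (p * b + d) = (a choose b) * (0 choose d)] (mod p)"
    using p d by (intro lucas_cong) (auto simp: prime_gt_0_nat)
  with d show ?thesis by (simp add: cong_0_iff binomial_eq_0)
qed

text \<open>The same Pascal-type induction works modulo \<open>p^2\<close>, since each middle
  Vandermonde term has two factors \<open>p\<close>: one from \<open>p choose i\<close>, one because
  \<open>p * b - i\<close> is not a multiple of \<open>p\<close>.\<close>

lemma babbage_cong:
  fixes p a b :: nat
  assumes p: "prime p"
  shows "[(p * a) choose (p * b) = a choose b] (mod p\<^sup>2)"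
proof (induction a arbitrary: b)
  case 0
  then show ?case using p by (cases "b = 0") (simp_all add: prime_gt_0_nat binomial_eq_0)
next
  case (Suc a)
  have step: "[(p + p * a) choose (p * b) = ((p * a) choose (p * b)) +
      (if p \<le> p * b then (p * a) choose (p * b - p) else 0)] (mod p\<^sup>2)"
  proof (intro binomial_add_cong)
    fix i assume i: "0 < i" "i < p" "i \<le> p * b"
    then obtain b' where b': "b = Suc b'" by (cases b) auto
    then have eq: "p * b - i = p * b' + (p - i)" using i by simp
    have "p dvd ((p * a) choose (p * b - i))"
      unfolding eq using p i by (intro prime_dvd_binomial_mult) auto
    moreover have "p dvd (p choose i)"
      using p i by (intro dvd_choose_prime) auto
    ultimately show "p\<^sup>2 dvd (p choose i) * ((p * a) choose (p * b - i))"
      unfolding power2_eq_square by (rule mult_dvd_mono[rotated])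
  qed (use p in \<open>simp add: prime_gt_0_nat\<close>)
  show ?case
  proof (cases b)
    case 0
    then show ?thesis by simp
  next
    case (Suc b')
    from cong_add[OF Suc.IH[of b] Suc.IH[of b']] step Suc show ?thesis
      by (auto simp: algebra_simps intro: cong_trans)
  qed
qed

text \<open>Writing \<open>(p b + d) C(p n, p b + d) = p n C(p n - 1, p b + d - 1)\<close> exposes the factor \<open>p\<close>,
  so that the remaining binomial coefficient is needed only modulo \<open>p\<close>.\<close>

lemma binomial_mult_offset_cong:
  fixes p n b d :: nat
  assumes p: "prime p" and d: "0 < d" "d < p" and n: "n > 0"
  shows "[(p * n) choose (p * b + d) = (n - b) * (n choose b) * (p choose d)] (mod p\<^sup>2)"
proof -
  obtain e where e: "d = Suc e" using d by (cases d) auto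
  obtain m where m: "n = Suc m" using n by (cases n) auto
  have p0: "p > 0" using p by (simp add: prime_gt_0_nat)
  let ?C = "(p * n) choose (p * b + d)"
  have "[(p * m + (p - 1)) choose (p * b + e) = (m choose b) * ((p - 1) choose e)] (mod p)"
    using p d e p0 by (intro lucas_cong) auto
  then have "[p * ((p * m + (p - 1)) choose (p * b + e)) = p * ((m choose b) * ((p - 1) choose e))] (mod p * p)"
    by (rule cong_cmult_leftI)
  then have 1: "[n * (p * ((p * m + (p - 1)) choose (p * b + e))) =
      n * (p * ((m choose b) * ((p - 1) choose e)))] (mod p\<^sup>2)"
    unfolding power2_eq_square by (rule cong_scalar_left)
  have "(p * b + d) * ?C = (p * n) * ((p * n - 1) choose (p * b + d - 1))"
    using d by (intro times_binomial_minus1_eq) auto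
  moreover have "p * n - 1 = p * m + (p - 1)" "p * b + d - 1 = p * b + e"
    using m e p0 by auto
  ultimately have 2: "(p * b + d) * ?C = n * (p * ((p * m + (p - 1)) choose (p * b + e)))"
    by simp
  have 3: "n * (m choose b) = (n - b) * (n choose b)"
    using binomial_absorb_comp[of n b] m by simp
  have 4: "p * ((p - 1) choose e) = d * (p choose d)"
    using times_binomial_minus1_eq[of d p] d e by simp
  \<comment> \<open>\<open>?C\<close> is itself divisible by \<open>p\<close>, so of
    \<open>(p * b + d) * ?C\<close> only \<open>d * ?C\<close> remains, and \<open>d\<close> is
    invertible.\<close>
  have "[p * b * ?C = 0] (mod p\<^sup>2)"
    using prime_dvd_binomial_mult[OF p d] by (auto simp: cong_0_iff power2_eq_square intro!: mult_dvd_mono)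
  then have "[p * b * ?C + d * ?C = 0 + d * ?C] (mod p\<^sup>2)"
    by (rule cong_add) simp
  then have "[d * ?C = (p * b + d) * ?C] (mod p\<^sup>2)"
    by (simp add: algebra_simps cong_sym_eq)
  also note 2
  also note 1
  also have "n * (p * ((m choose b) * ((p - 1) choose e))) = n * (m choose b) * (p * ((p - 1) choose e))"
    by simp
  also have "\<dots> = d * ((n - b) * (n choose b) * (p choose d))"
    unfolding 3 4 by simp
  finally have "[d * ?C = d * ((n - b) * (n choose b) * (p choose d))] (mod p\<^sup>2)" .
  moreover have "coprime d (p\<^sup>2)"
    using d p by (metis coprime_commute coprime_power_right_iff nat_dvd_not_less prime_imp_coprime)
  ultimately show ?thesis
    by (simp add: cong_mult_lcancel_nat)
qed

subsection \<open>Harmonic sums modulo a prime\<close>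

lemma coprime_int_prime_power:
  assumes "prime p" "\<not> p dvd k"
  shows "coprime (int k) (int p ^ n)"
proof -
  have "coprime k p"
    using prime_imp_coprime[OF assms] by (simp add: coprime_commute)
  then have "coprime (int k) (int p)" by simp
  then show ?thesis by simp
qed

lemma prime_div_3:
  fixes p :: nat
  assumes "prime p" "p > 3"
  shows "p = 3 * (p div 3) + 1 \<or> p = 3 * (p div 3) + 2"
proof -
  have "\<not> 3 dvd p" using assms by (auto simp: prime_nat_iff)
  then show ?thesis by presburger
qed

lemma fermat_power_cong:
  assumes "prime p"
  shows "[int a ^ p = int a] (mod int p)"
proof (cases "p dvd a")
  case True
  then have "int p dvd int a" by simp
  moreover from this have "int p dvd int a ^ p"
    using assms by (intro dvd_trans[OF \<open>int p dvd int a\<close>] dvd_power) (simp add: prime_gt_0_nat)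
  ultimately show ?thesis
    by (simp add: cong_iff_dvd_diff)
next
  case False
  have "[a * a ^ (p - 1) = a * 1] (mod p)"
    using assms False by (intro cong_scalar_left fermat_theorem)
  then have "[a ^ p = a] (mod p)"
    using assms by (simp add: prime_gt_0_nat flip: power_Suc)
  then show ?thesis by (metis cong_int_iff of_nat_power)
qed

text \<open>By Fermat an inverse modulo \<open>p\<close> of any \<open>k\<close> prime to
  \<open>p\<close>. An explicit power is multiplicative in \<open>k\<close> and respects
  congruences.\<close>

definition prime_inverse :: "nat \<Rightarrow> nat \<Rightarrow> int" where
  "prime_inverse p k = int k ^ (p - 2)"

lemma prime_inverse:
  assumes "prime p" "p > 2" "\<not> p dvd k"
  shows "[int k * prime_inverse p k = 1] (mod int p)"
proof -
  have "int k * prime_inverse p k = int (k ^ (p - 1))"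
    using \<open>p > 2\<close> by (simp add: prime_inverse_def flip: power_Suc) (simp add: Suc_diff_Suc numeral_2_eq_2)
  moreover have "[k ^ (p - 1) = 1] (mod p)"
    using assms by (intro fermat_theorem) auto
  ultimately show ?thesis
    by (metis cong_int_iff of_nat_1)
qed

lemma prime_inverse_complement:
  assumes "prime p" "p > 2" "k \<le> p"
  shows "[prime_inverse p (p - k) = - prime_inverse p k] (mod int p)"
proof -
  have "odd p" using assms prime_odd_nat by auto
  then have "odd (p - 2)" using \<open>p > 2\<close> by simp
  have "[int (p - k) = - int k] (mod int p)"
    using \<open>k \<le> p\<close> by (simp add: of_nat_diff cong_iff_dvd_diff)
  then have "[int (p - k) ^ (p - 2) = (- int k) ^ (p - 2)] (mod int p)"
    by (rule cong_pow)
  then show ?thesis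
    using \<open>odd (p - 2)\<close> by (simp add: prime_inverse_def)
qed

text \<open>Coefficient of \<open>x^M\<close> in \<open>(1 + x)^(-M) * (1 + x)^M = 1\<close>;
  negating the upper index turns the coefficients of the first factor into signed binomials.\<close>

lemma sum_alternating_binomial_mult:
  assumes "M > 0"
  shows "(\<Sum>r = 0..M. (-1) ^ r * int (M choose r) * int ((M - 1 + r) choose r)) = 0"
proof -
  have "(\<Sum>r = 0..M. (- rat_of_nat M gchoose r) * (rat_of_nat M gchoose (M - r))) = 0 gchoose M"
    by (subst gbinomial_Vandermonde) simp
  also have "\<dots> = 0"
    using assms by (cases M) auto
  finally have "(\<Sum>r = 0..M. (- rat_of_nat M gchoose r) * (rat_of_nat M gchoose (M - r))) = 0" .
  moreover have "(- rat_of_nat M gchoose r) * (rat_of_nat M gchoose (M - r)) =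
      rat_of_int ((-1) ^ r * int (M choose r) * int ((M - 1 + r) choose r))" if "r \<in> {0..M}" for r
  proof -
    have "- rat_of_nat M gchoose r = (-1) ^ r * (rat_of_nat (M - 1 + r) gchoose r)"
      using assms by (subst gbinomial_minus) (simp add: of_nat_diff algebra_simps)
    moreover have "rat_of_nat M gchoose (M - r) = rat_of_nat (M choose r)"
      using that by (simp flip: binomial_gbinomial binomial_symmetric)
    ultimately show ?thesis
      by (simp add: binomial_gbinomial mult_ac)
  qed
  ultimately have "rat_of_int (\<Sum>r = 0..M. (-1) ^ r * int (M choose r) * int ((M - 1 + r) choose r)) = 0"
    by simp
  then show ?thesis by (simp only: of_int_eq_0_iff)
qed

text \<open>After multiplication by \<open>m + 1\<close> the two products are
  \<open>m + 1 + r\<close> and \<open>m + 1 - r\<close> times a common value. The resulting factor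
  \<open>r\<close> is what cancels \<open>1/r\<close> in the next sum.\<close>

lemma binomial_mult_binomial_diff:
  "int (Suc m) * (int (Suc m choose r) * int ((Suc m + r) choose r)
      - int (m choose r) * int ((m + r) choose r)) =
    2 * int r * (int (Suc m choose r) * int ((m + r) choose r))"
proof -
  have 1: "int (Suc m) * int (m choose r) = (int (Suc m) - int r) * int (Suc m choose r)"
  proof (cases "r \<le> Suc m")
    case True
    have "(Suc m - r) * (Suc m choose r) = Suc m * (m choose r)"
      using binomial_absorb_comp[of "Suc m" r] by simp
    then have "int (Suc m - r) * int (Suc m choose r) = int (Suc m) * int (m choose r)"
      by (metis of_nat_mult)
    with True show ?thesis by (simp add: of_nat_diff)
  qed (simp add: binomial_eq_0)
  have "(Suc m + r - r) * ((Suc m + r) choose r) = (Suc m + r) * ((m + r) choose r)"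
    using binomial_absorb_comp[of "Suc m + r" r] by simp
  then have 2: "int (Suc m) * int ((Suc m + r) choose r) = (int (Suc m) + int r) * int ((m + r) choose r)"
    by (metis add_diff_cancel_right' of_nat_add of_nat_mult)
  have "int (Suc m) * (int (Suc m choose r) * int ((Suc m + r) choose r)
      - int (m choose r) * int ((m + r) choose r)) =
    int (Suc m choose r) * (int (Suc m) * int ((Suc m + r) choose r))
      - (int (Suc m) * int (m choose r)) * int ((m + r) choose r)"
    by (simp only: algebra_simps)
  also have "\<dots> = 2 * int r * (int (Suc m choose r) * int ((m + r) choose r))"
    unfolding 1 2 by (simp only: algebra_simps)
  finally show ?thesis .
qed

text \<open>Passing from \<open>m\<close> to \<open>m + 1\<close> changes the left side by
  \<open>-2/(m + 1)\<close>, exactly as the right side; \<open>m < p\<close> keeps every index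
  invertible.\<close>

lemma sum_binomial_prime_inverse:
  assumes p: "prime p" "p > 2" and "m < p"
  shows "[(\<Sum>r = 1..m. (-1) ^ r * (int (m choose r) * int ((m + r) choose r)) * prime_inverse p r)
      = - 2 * (\<Sum>k = 1..m. prime_inverse p k)] (mod int p)"
  using \<open>m < p\<close>
proof (induction m)
  case (Suc m)
  define F where "F m = (\<Sum>r = 1..m. (-1) ^ r * (int (m choose r) * int ((m + r) choose r)) * prime_inverse p r)" for m
  have inv: "[int r * prime_inverse p r = 1] (mod int p)" if "r \<in> {1..Suc m}" for r
    using that p Suc.prems by (intro prime_inverse) (auto dest: dvd_imp_le)
  have "F m = (\<Sum>r = 1..Suc m. (-1) ^ r * (int (m choose r) * int ((m + r) choose r)) * prime_inverse p r)"
    by (simp add: F_def binomial_eq_0)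
  then have "int (Suc m) * (F (Suc m) - F m) =
      (\<Sum>r = 1..Suc m. (-1) ^ r * (int (Suc m) * (int (Suc m choose r) * int ((Suc m + r) choose r)
      - int (m choose r) * int ((m + r) choose r))) * prime_inverse p r)"
    unfolding F_def by (simp only: sum_distrib_left flip: sum_subtractf) (simp only: algebra_simps)
  also have "\<dots> = (\<Sum>r = 1..Suc m. 2 * ((-1) ^ r * int (Suc m choose r) * int ((m + r) choose r)) *
      (int r * prime_inverse p r))"
    unfolding binomial_mult_binomial_diff by (simp only: mult_ac)
  also have "[\<dots> = (\<Sum>r = 1..Suc m. 2 * ((-1) ^ r * int (Suc m choose r) * int ((m + r) choose r)) * 1)] (mod int p)"
    by (intro cong_sum cong_mult inv cong_refl)
  \<comment> \<open>The alternating sum from \<open>r = 0\<close> vanishes and its term at 0 is 1,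
    so the rest is -1.\<close>
  also have "(\<Sum>r = 1..Suc m. 2 * ((-1) ^ r * int (Suc m choose r) * int ((m + r) choose r)) * 1) = - 2"
    using sum_alternating_binomial_mult[of "Suc m"]
    by (simp add: sum.atLeast_Suc_atMost[of 0] flip: sum_distrib_left)
  finally have "[int (Suc m) * (F (Suc m) - F m) = - 2] (mod int p)" .
  then have "[prime_inverse p (Suc m) * (int (Suc m) * (F (Suc m) - F m)) = prime_inverse p (Suc m) * (- 2)] (mod int p)"
    by (rule cong_scalar_left)
  moreover have "[int (Suc m) * prime_inverse p (Suc m) * (F (Suc m) - F m) = 1 * (F (Suc m) - F m)] (mod int p)"
    by (intro cong_scalar_right inv) simp
  ultimately have "[F (Suc m) - F m = prime_inverse p (Suc m) * (- 2)] (mod int p)"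
    by (metis (no_types, opaque_lifting) cong_sym cong_trans mult.assoc mult.commute mult_1)
  moreover have "[F m = - 2 * (\<Sum>k = 1..m. prime_inverse p k)] (mod int p)"
    using Suc unfolding F_def by simp
  ultimately have "[(F (Suc m) - F m) + F m = prime_inverse p (Suc m) * (- 2) + - 2 * (\<Sum>k = 1..m. prime_inverse p k)] (mod int p)"
    by (rule cong_add)
  then show ?case
    by (simp add: F_def[of "Suc m"] algebra_simps)
qed simp

subsection \<open>The Fermat quotient of 3\<close>

lemma sum_reflect:
  fixes f :: "nat \<Rightarrow> 'a::comm_monoid_add"
  assumes "m < p"
  shows "(\<Sum>k = p - m..p - 1. f k) = (\<Sum>k = 1..m. f (p - k))"
  using assms by (intro sum.reindex_bij_witness[of _ "\<lambda>k. p - k" "\<lambda>k. p - k"]) auto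

lemma sum_prime_inverse_reflect:
  assumes "prime p" "p > 2" "m < p"
  shows "[(\<Sum>k = p - m..p - 1. prime_inverse p k) = - (\<Sum>k = 1..m. prime_inverse p k)] (mod int p)"
  unfolding sum_reflect[OF \<open>m < p\<close>] sum_negf[symmetric]
  using assms by (intro cong_sum prime_inverse_complement) auto

text \<open>The reflection \<open>k\<close> to \<open>p - k\<close> makes the full sum its own
  negative, hence zero modulo the odd prime \<open>p\<close>; the tail is then minus the initial
  part.\<close>

lemma sum_prime_inverse_upper:
  assumes p: "prime p" "p > 2" "m < p"
  shows "[(\<Sum>k = Suc m..p - 1. prime_inverse p k) = - (\<Sum>k = 1..m. prime_inverse p k)] (mod int p)"
proof -
  define H where "H = (\<Sum>k = 1..p - 1. prime_inverse p k)"
  have "[H = - H] (mod int p)"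
    using sum_prime_inverse_reflect[of p "p - 1"] p by (simp add: H_def)
  then have "int p dvd 2 * H"
    by (simp add: cong_iff_dvd_diff)
  moreover have "coprime (int p) 2"
    using p by (metis coprime_right_2_iff_odd even_of_nat prime_odd_nat)
  ultimately have "int p dvd H"
    by (simp add: coprime_dvd_mult_right_iff)
  moreover have "H = (\<Sum>k = 1..m. prime_inverse p k) + (\<Sum>k = Suc m..p - 1. prime_inverse p k)"
    using p sum.ub_add_nat[of 1 m "prime_inverse p" "p - 1 - m"] by (simp add: H_def)
  ultimately show ?thesis
    by (simp add: cong_iff_dvd_diff add.commute)
qed

text \<open>For \<open>0 < k < p\<close> the quotient \<open>3 * k div p\<close> counts how many of
  \<open>k > m\<close> and \<open>k \<ge> p - m\<close> hold, where \<open>m = p div 3\<close>. Each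
  of these two tails contributes minus the harmonic sum up to \<open>m\<close>.\<close>

lemma sum_floor_prime_inverse:
  assumes p: "prime p" "p > 3"
  shows "[(\<Sum>k = 1..p - 1. int (3 * k div p) * prime_inverse p k) =
      - 2 * (\<Sum>k = 1..p div 3. prime_inverse p k)] (mod int p)"
proof -
  define m where "m = p div 3"
  have m: "m < p" "3 * m < p" "p < 3 * m + 3"
    using prime_div_3[OF p] unfolding m_def by linarith+
  have "int (3 * k div p) * prime_inverse p k =
      (if k \<in> {Suc m..p - 1} then prime_inverse p k else 0) +
      (if k \<in> {p - m..p - 1} then prime_inverse p k else 0)" if k: "k \<in> {1..p - 1}" for k
  proof -
    consider "k \<le> m" | "m < k" "k < p - m" | "p - m \<le> k" by linarith
    then show ?thesis
    proof cases
      case 1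
      then have "3 * k < p" "k < p - m" using m by linarith+
      then show ?thesis using 1 by simp
    next
      case 2
      have "p \<le> 3 * k" "3 * k < 2 * p" using 2 m by linarith+
      then have "3 * k div p = 1" by (intro div_nat_eqI) simp_all
      then show ?thesis using 2 k by simp
    next
      case 3
      have "2 * p \<le> 3 * k" "k < p" using 3 m k by auto
      then have "3 * k div p = 2" by (intro div_nat_eqI) simp_all
      moreover have "m < k" using 3 m by linarith
      ultimately show ?thesis using 3 k by simp
    qed
  qed
  then have "(\<Sum>k = 1..p - 1. int (3 * k div p) * prime_inverse p k) =
      (\<Sum>k = 1..p - 1. (if k \<in> {Suc m..p - 1} then prime_inverse p k else 0) +
        (if k \<in> {p - m..p - 1} then prime_inverse p k else 0))"
    by (rule sum.cong[OF refl])
  also have "\<dots> = (\<Sum>k \<in> {1..p - 1} \<inter> {Suc m..p - 1}. prime_inverse p k) +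
      (\<Sum>k \<in> {1..p - 1} \<inter> {p - m..p - 1}. prime_inverse p k)"
    unfolding sum.distrib by (simp only: sum.inter_restrict finite_atLeastAtMost)
  also have "{1..p - 1} \<inter> {Suc m..p - 1} = {Suc m..p - 1}"
    by auto
  also have "{1..p - 1} \<inter> {p - m..p - 1} = {p - m..p - 1}"
    using m by auto
  also have "[(\<Sum>k = Suc m..p - 1. prime_inverse p k) + (\<Sum>k = p - m..p - 1. prime_inverse p k) =
      - (\<Sum>k = 1..m. prime_inverse p k) + - (\<Sum>k = 1..m. prime_inverse p k)] (mod int p)"
    using p m by (intro cong_add sum_prime_inverse_upper sum_prime_inverse_reflect) auto
  finally show ?thesis by (simp add: m_def)
qed

text \<open>Only the constant and linear parts of the expanded product survive modulo
  \<open>q^2\<close>.\<close>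

lemma prod_one_minus_cong:
  fixes q :: int
  assumes "finite A"
  shows "[(\<Prod>k\<in>A. 1 - q * f k) = 1 - q * (\<Sum>k\<in>A. f k)] (mod q\<^sup>2)"
  using assms
proof induction
  case (insert a A)
  have "[(1 - q * f a) * (\<Prod>k\<in>A. 1 - q * f k) = (1 - q * f a) * (1 - q * sum f A)] (mod q\<^sup>2)"
    by (rule cong_scalar_left) fact
  also have "(1 - q * f a) * (1 - q * sum f A) = 1 - q * (f a + sum f A) + q\<^sup>2 * (f a * sum f A)"
    by (simp add: algebra_simps power2_eq_square)
  also have "[\<dots> = 1 - q * (f a + sum f A)] (mod q\<^sup>2)"
    by (simp add: cong_iff_dvd_diff)
  finally show ?case using insert by simp
qed simp

lemma prime_dvd_cong_power2:
  fixes q :: int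
  assumes "[a = b] (mod q)" "q dvd c"
  shows "[c * a = c * b] (mod q\<^sup>2)"
  using assms by (auto simp: cong_iff_dvd_diff power2_eq_square simp flip: right_diff_distrib)

text \<open>Multiplication by a unit permutes the nonzero residues.\<close>

lemma prod_mult_mod:
  assumes "prime p" "\<not> p dvd a"
  shows "(\<Prod>k = 1..p - 1. a * k mod p) = fact (p - 1)"
proof -
  have "inj_on (\<lambda>k. a * k mod p) {1..p - 1}"
  proof
    fix x y assume x: "x \<in> {1..p - 1}" and y: "y \<in> {1..p - 1}" and "a * x mod p = a * y mod p"
    then have "[a * x = a * y] (mod p)" by (simp add: cong_def)
    moreover have "coprime a p" using prime_imp_coprime[OF assms] by (simp add: coprime_commute)
    ultimately have "[x = y] (mod p)" by (simp add: cong_mult_lcancel_nat)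
    with x y show "x = y" by (auto simp: cong_def)
  qed
  moreover have "(\<lambda>k. a * k mod p) ` {1..p - 1} \<subseteq> {1..p - 1}"
  proof clarify
    fix k assume k: "k \<in> {1..p - 1}"
    then have "\<not> p dvd k" by (auto dest: dvd_imp_le)
    with assms have "\<not> p dvd a * k" by (simp add: prime_dvd_mult_iff)
    then have "a * k mod p \<noteq> 0" by (simp add: dvd_eq_mod_eq_0)
    moreover have "a * k mod p < p" using assms by (simp add: prime_gt_0_nat)
    ultimately show "a * k mod p \<in> {1..p - 1}" by auto
  qed
  ultimately have "bij_betw (\<lambda>k. a * k mod p) {1..p - 1} {1..p - 1}"
    by (simp add: bij_betw_def endo_inj_surj)
  then show ?thesis
    by (simp add: prod.reindex_bij_betw[of _ _ _ "\<lambda>k. k"] fact_prod)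
qed

text \<open>Modulo \<open>p^2\<close>, \<open>3k mod p = 3k * (1 - p * (3k div p) / (3k))\<close>.
  The product over \<open>k\<close>, with \<open>(p-1)!\<close> cancelled, gives
  \<open>3^(p-1) * (1 - p * \<Sigma>) = 1\<close>, where \<open>3 * \<Sigma>\<close> is minus twice
  the harmonic sum modulo \<open>p\<close>.\<close>

lemma power_3_prime_cong:
  assumes p: "prime p" "p > 3"
  shows "[3 ^ p = 3 - 2 * int p * (\<Sum>k = 1..p div 3. prime_inverse p k)] (mod (int p)\<^sup>2)"
proof -
  define H where "H = (\<Sum>k = 1..p div 3. prime_inverse p k)"
  define \<Sigma> where "\<Sigma> = (\<Sum>k = 1..p - 1. int (3 * k div p) * prime_inverse p (3 * k))"
  have n3: "\<not> p dvd 3" using p by (auto dest: dvd_imp_le)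
  have fermat: "[int 3 * prime_inverse p 3 = 1] (mod int p)"
    using p n3 by (intro prime_inverse) auto
  have "[3 * \<Sigma> = - 2 * H] (mod int p)"
  proof -
    have "3 * \<Sigma> = (int 3 * prime_inverse p 3) * (\<Sum>k = 1..p - 1. int (3 * k div p) * prime_inverse p k)"
      by (simp add: \<Sigma>_def prime_inverse_def power_mult_distrib sum_distrib_left mult_ac)
    also have "[\<dots> = 1 * (- 2 * H)] (mod int p)"
      unfolding H_def by (intro cong_mult fermat sum_floor_prime_inverse p)
    finally show ?thesis by simp
  qed
  then have "[3 ^ p * int p * (3 * \<Sigma>) = 3 ^ p * int p * (- 2 * H)] (mod (int p)\<^sup>2)"
    by (rule prime_dvd_cong_power2) simp
  moreover have "[3 ^ p * int p * (- 2 * H) = int p * (- 2 * H) * 3] (mod (int p)\<^sup>2)"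
  proof -
    have "[3 ^ p = 3] (mod int p)"
      using fermat_power_cong[OF p(1), of 3] by simp
    then have "[int p * (- 2 * H) * 3 ^ p = int p * (- 2 * H) * 3] (mod (int p)\<^sup>2)"
      by (rule prime_dvd_cong_power2) simp
    then show ?thesis by (simp add: mult_ac)
  qed
  ultimately have A: "[3 ^ p * int p * (3 * \<Sigma>) = int p * (- 2 * H) * 3] (mod (int p)\<^sup>2)"
    by (rule cong_trans)
  have rem: "[int (3 * k) * (1 - int p * (int (3 * k div p) * prime_inverse p (3 * k))) = int (3 * k mod p)]
      (mod (int p)\<^sup>2)" if k: "k \<in> {1..p - 1}" for k
  proof -
    have "\<not> p dvd 3 * k"
      using k p n3 by (auto simp: prime_dvd_mult_iff dest: dvd_imp_le)
    then have "[int p * int (3 * k div p) * (int (3 * k) * prime_inverse p (3 * k)) =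
        int p * int (3 * k div p) * 1] (mod (int p)\<^sup>2)"
      using p by (intro prime_dvd_cong_power2 prime_inverse) auto
    then have "[int (3 * k) - int p * int (3 * k div p) * (int (3 * k) * prime_inverse p (3 * k)) =
        int (3 * k) - int p * int (3 * k div p) * 1] (mod (int p)\<^sup>2)"
      by (intro cong_diff) auto
    moreover have "int (3 * k) - int p * int (3 * k div p) * 1 = int (3 * k mod p)"
      by (metis minus_mult_div_eq_mod mult_1_right of_nat_div of_nat_mod)
    moreover have "int (3 * k) * (1 - int p * (int (3 * k div p) * prime_inverse p (3 * k))) =
        int (3 * k) - int p * int (3 * k div p) * (int (3 * k) * prime_inverse p (3 * k))"
      by (simp only: right_diff_distrib mult_ac mult_1_right)
    ultimately show ?thesis by simp
  qed
  have "(\<Prod>k = 1..p - 1. int (3 * k)) = 3 ^ (p - 1) * fact (p - 1)"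
    by (simp add: prod.distrib fact_prod)
  then have "3 ^ (p - 1) * fact (p - 1) * (\<Prod>k = 1..p - 1. 1 - int p * (int (3 * k div p) * prime_inverse p (3 * k)))
      = (\<Prod>k = 1..p - 1. int (3 * k) * (1 - int p * (int (3 * k div p) * prime_inverse p (3 * k))))"
    by (simp only: prod.distrib)
  also have "[\<dots> = (\<Prod>k = 1..p - 1. int (3 * k mod p))] (mod (int p)\<^sup>2)"
    by (rule cong_prod) (rule rem)
  also have "(\<Prod>k = 1..p - 1. int (3 * k mod p)) = fact (p - 1)"
    unfolding of_nat_prod[symmetric] using prod_mult_mod[OF p(1) n3] by simp
  finally have "[3 ^ (p - 1) * fact (p - 1) * (\<Prod>k = 1..p - 1. 1 - int p * (int (3 * k div p) * prime_inverse p (3 * k)))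
      = fact (p - 1)] (mod (int p)\<^sup>2)" .
  moreover have "[3 ^ (p - 1) * fact (p - 1) * (\<Prod>k = 1..p - 1. 1 - int p * (int (3 * k div p) * prime_inverse p (3 * k)))
      = 3 ^ (p - 1) * fact (p - 1) * (1 - int p * \<Sigma>)] (mod (int p)\<^sup>2)"
    unfolding \<Sigma>_def by (intro cong_scalar_left prod_one_minus_cong) simp
  ultimately have "[3 ^ (p - 1) * fact (p - 1) * (1 - int p * \<Sigma>) = fact (p - 1)] (mod (int p)\<^sup>2)"
    using cong_sym cong_trans by blast
  then have "[fact (p - 1) * (3 ^ (p - 1) * (1 - int p * \<Sigma>)) = fact (p - 1) * 1] (mod (int p)\<^sup>2)"
    by (simp only: mult_ac mult_1_left mult_1_right)
  moreover have "\<not> p dvd fact (p - 1)"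
    using p by (simp add: prime_dvd_fact_iff prime_gt_0_nat)
  then have "coprime (fact (p - 1)) ((int p)\<^sup>2)"
    using coprime_int_prime_power[OF p(1), of "fact (p - 1)" 2] by simp
  ultimately have "[3 ^ (p - 1) * (1 - int p * \<Sigma>) = 1] (mod (int p)\<^sup>2)"
    by (simp only: cong_mult_lcancel)
  \<comment> \<open>One factor 3 completes \<open>3 ^ p\<close>; the other forms
    \<open>3 * \<Sigma>\<close>, so that \<open>A\<close> applies.\<close>
  then have "[9 * (3 ^ (p - 1) * (1 - int p * \<Sigma>)) = 9 * 1] (mod (int p)\<^sup>2)"
    by (rule cong_scalar_left)
  moreover have "9 * (3 ^ (p - 1) * (1 - int p * \<Sigma>)) = 3 * 3 ^ p - 3 ^ p * int p * (3 * \<Sigma>)"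
    using p by (cases p) (simp_all add: algebra_simps)
  ultimately have "[3 * 3 ^ p - 3 ^ p * int p * (3 * \<Sigma>) = 9] (mod (int p)\<^sup>2)"
    by simp
  from cong_add[OF this A] have "[3 * 3 ^ p = 3 * (3 - 2 * int p * H)] (mod (int p)\<^sup>2)"
    by (simp add: algebra_simps)
  moreover have "coprime 3 ((int p)\<^sup>2)"
    using coprime_int_prime_power[OF p(1) n3, of 2] by simp
  ultimately show ?thesis
    unfolding H_def by (simp only: cong_mult_lcancel)
qed

subsection \<open>The trinomial sum at a prime\<close>

text \<open>The multinomial coefficient \<open>(3r)!/(r!)^3\<close>, kept as two binomials so that
  Lucas and Babbage apply to each.\<close>

definition trinom :: "nat \<Rightarrow> int" where
  "trinom r = int ((3 * r) choose r) * int ((2 * r) choose r)"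

lemma trinom_mult_fact: "trinom r * fact r ^ 3 = fact (3 * r)"
proof -
  have "fact r * fact (3 * r - r) * ((3 * r) choose r) = (fact (3 * r) :: nat)"
    by (rule binomial_fact_lemma) simp
  moreover have "3 * r - r = 2 * r" by simp
  ultimately have "int (fact r * fact (2 * r) * ((3 * r) choose r)) = int (fact (3 * r))"
    by (simp only:)
  then have 1: "fact r * fact (2 * r) * int ((3 * r) choose r) = fact (3 * r)"
    by simp
  have "fact r * fact (2 * r - r) * ((2 * r) choose r) = (fact (2 * r) :: nat)"
    by (rule binomial_fact_lemma) simp
  then have "int (fact r * fact r * ((2 * r) choose r)) = int (fact (2 * r))"
    by (simp add: mult_2)
  then have 2: "fact r * fact r * int ((2 * r) choose r) = fact (2 * r)"
    by simp
  show ?thesis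
    unfolding 1[symmetric] 2[symmetric] trinom_def by (simp add: power3_eq_cube)
qed

lemma trinom_Suc:
  "(int (Suc r))\<^sup>2 * trinom (Suc r) = 3 * (3 * int r + 1) * (3 * int r + 2) * trinom r"
proof -
  have *: "3 * Suc r = Suc (Suc (Suc (3 * r)))" by simp
  have "int (Suc r) * fact r ^ 3 * ((int (Suc r))\<^sup>2 * trinom (Suc r)) = trinom (Suc r) * fact (Suc r) ^ 3"
    by (simp add: power_mult_distrib power2_eq_square power3_eq_cube)
  also have "\<dots> = (3 * int r + 3) * (3 * int r + 2) * (3 * int r + 1) * fact (3 * r)"
    unfolding trinom_mult_fact unfolding * fact_Suc by (simp add: algebra_simps)
  also have "\<dots> = int (Suc r) * fact r ^ 3 * (3 * (3 * int r + 1) * (3 * int r + 2) * trinom r)"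
    unfolding trinom_mult_fact[symmetric] by (simp add: algebra_simps)
  finally show ?thesis by simp
qed

text \<open>Both sides satisfy first-order recurrences in \<open>r\<close> whose ratios agree modulo
  \<open>p\<close>, because \<open>p\<close> is \<open>3m + 1\<close> or
  \<open>3m + 2\<close>.\<close>

lemma trinom_cong:
  assumes p: "prime p" "p > 3" and m: "m = p div 3" and "r \<le> m"
  shows "[trinom r = (-27) ^ r * (int (m choose r) * int ((m + r) choose r))] (mod int p)"
  using \<open>r \<le> m\<close>
proof (induction r)
  case 0
  then show ?case by (simp add: trinom_def)
next
  case (Suc r)
  define B where "B r = int (m choose r) * int ((m + r) choose r)" for r
  \<comment> \<open>The numerators of the two ratios differ by a quantity independent of
    \<open>r\<close>.\<close>
  have "3 * (3 * int r + 1) * (3 * int r + 2) - (-27) * ((int m - int r) * (int m + int r + 1)) =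
      3 * ((3 * int m + 1) * (3 * int m + 2))"
    by (simp add: algebra_simps)
  moreover have "int p dvd (3 * int m + 1) * (3 * int m + 2)"
  proof -
    have "int p = 3 * int m + 1 \<or> int p = 3 * int m + 2"
      using prime_div_3[OF p] unfolding m[symmetric] by presburger
    then show ?thesis by auto
  qed
  ultimately have q: "[3 * (3 * int r + 1) * (3 * int r + 2) = (-27) * ((int m - int r) * (int m + int r + 1))] (mod int p)"
    by (simp only: cong_iff_dvd_diff dvd_mult)
  have "Suc r * (m choose Suc r) = (m - r) * (m choose r)"
    using binomial_absorption[of r m] binomial_absorb_comp[of m r] by simp
  then have "int (Suc r) * int (m choose Suc r) = int (m - r) * int (m choose r)"
    by (metis of_nat_mult)
  then have 1: "int (Suc r) * int (m choose Suc r) = (int m - int r) * int (m choose r)"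
    using Suc.prems by (simp add: of_nat_diff)
  have "Suc r * ((m + Suc r) choose Suc r) = (m + r + 1) * ((m + r) choose r)"
    using Suc_times_binomial[of r "m + r"] by simp
  then have 2: "int (Suc r) * int ((m + Suc r) choose Suc r) = (int m + int r + 1) * int ((m + r) choose r)"
    by (metis of_nat_mult of_nat_add of_nat_1)
  have "(int (Suc r))\<^sup>2 * trinom (Suc r) = 3 * (3 * int r + 1) * (3 * int r + 2) * trinom r"
    by (rule trinom_Suc)
  also have "[\<dots> = (-27) * ((int m - int r) * (int m + int r + 1)) * ((-27) ^ r * B r)] (mod int p)"
    using Suc by (intro cong_mult q) (simp add: B_def)
  also have "(-27) * ((int m - int r) * (int m + int r + 1)) * ((-27) ^ r * B r) =
      (-27) ^ Suc r * (((int m - int r) * int (m choose r)) * ((int m + int r + 1) * int ((m + r) choose r)))"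
    by (simp only: B_def power_Suc mult_ac)
  also have "\<dots> = (int (Suc r))\<^sup>2 * ((-27) ^ Suc r * B (Suc r))"
    unfolding 1[symmetric] 2[symmetric] B_def power2_eq_square by (simp only: mult_ac)
  finally have "[(int (Suc r))\<^sup>2 * trinom (Suc r) = (int (Suc r))\<^sup>2 * ((-27) ^ Suc r * B (Suc r))] (mod int p)" .
  moreover have "coprime ((int (Suc r))\<^sup>2) (int p)"
  proof -
    have "Suc r < p" using Suc.prems m p by auto
    then have "\<not> p dvd Suc r" by (auto dest: dvd_imp_le)
    then show ?thesis using coprime_int_prime_power[OF p(1), of "Suc r" 1] by simp
  qed
  ultimately show ?case
    unfolding B_def by (simp only: cong_mult_lcancel)
qed

text \<open>Neighbours in row \<open>p - 1\<close> of Pascal's triangle add up to an inner entry of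
  row \<open>p\<close>, so they are opposite modulo \<open>p\<close>.\<close>

lemma prime_minus_1_binomial_cong:
  assumes "prime p" "k < p"
  shows "[int ((p - 1) choose k) = (-1) ^ k] (mod int p)"
  using \<open>k < p\<close>
proof (induction k)
  case (Suc k)
  have "p choose Suc k = ((p - 1) choose k) + ((p - 1) choose Suc k)"
    using Suc.prems binomial_Suc_Suc[of "p - 1" k] by simp
  moreover have "p dvd (p choose Suc k)"
    using assms Suc.prems by (intro dvd_choose_prime) auto
  ultimately have "[int ((p - 1) choose k) + int ((p - 1) choose Suc k) = 0] (mod int p)"
    by (metis cong_0_iff of_nat_add of_nat_dvd_iff)
  moreover have "[int ((p - 1) choose k) = (-1) ^ k] (mod int p)"
    using Suc by simp
  ultimately have "[int ((p - 1) choose k) + int ((p - 1) choose Suc k) - int ((p - 1) choose k) = 0 - (-1) ^ k] (mod int p)"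
    by (rule cong_diff)
  then show ?case by simp
qed simp

text \<open>From \<open>3r * C(p,3r) = p * C(p-1,3r-1)\<close> comes a factor \<open>p\<close>, so
  the other factors matter only modulo \<open>p\<close>. There the powers of 3 combine to
  \<open>3^p = 3\<close>, which cancels the 3 in \<open>3r\<close>.\<close>

lemma trinom_term_cong:
  assumes p: "prime p" "p > 3" and m: "m = p div 3" and r: "r \<in> {1..m}"
  shows "[(-1) ^ r * trinom r * int (p choose (3 * r)) * 3 ^ (p - 3 * r) =
     - int p * ((-1) ^ r * (int (m choose r) * int ((m + r) choose r)) * prime_inverse p r)]
     (mod (int p)\<^sup>2)"
proof -
  define B where "B = int (m choose r) * int ((m + r) choose r)"
  define V where "V = prime_inverse p r"
  have r3: "0 < r" "r < p" "3 * r < p"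
    using prime_div_3[OF p] r unfolding m[symmetric] by auto
  have "3 * r * (p choose (3 * r)) = p * ((p - 1) choose (3 * r - 1))"
    using r3 by (intro times_binomial_minus1_eq) simp
  then have ab: "3 * int r * int (p choose (3 * r)) = int p * int ((p - 1) choose (3 * r - 1))"
    by (metis of_nat_mult of_nat_numeral)
  have "[int r * V = 1] (mod int p)"
    unfolding V_def using p r3 by (intro prime_inverse) (auto dest: dvd_imp_le)
  moreover have dvd: "int p dvd int (p choose (3 * r))"
    using p r3 by (subst of_nat_dvd_iff, intro dvd_choose_prime) auto
  ultimately have "[int (p choose (3 * r)) * (int r * V) = int (p choose (3 * r)) * 1] (mod (int p)\<^sup>2)"
    by (rule prime_dvd_cong_power2)
  then have "[3 * (int (p choose (3 * r)) * (int r * V)) = 3 * (int (p choose (3 * r)) * 1)] (mod (int p)\<^sup>2)"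
    by (rule cong_scalar_left)
  moreover have "3 * (int (p choose (3 * r)) * (int r * V)) = int p * (int ((p - 1) choose (3 * r - 1)) * V)"
    using ab by (simp add: mult_ac)
  ultimately have C: "[3 * int (p choose (3 * r)) = int p * (int ((p - 1) choose (3 * r - 1)) * V)] (mod (int p)\<^sup>2)"
    by (simp add: cong_sym_eq)
  have "[trinom r * int ((p - 1) choose (3 * r - 1)) * 3 ^ (p - 3 * r) =
      ((-27) ^ r * B) * (-1) ^ (3 * r - 1) * 3 ^ (p - 3 * r)] (mod int p)"
    unfolding B_def using p m r r3
    by (intro cong_mult trinom_cong prime_minus_1_binomial_cong) auto
  also have "((-27) ^ r * B) * (-1) ^ (3 * r - 1) * 3 ^ (p - 3 * r) = - (B * 3 ^ p)"
  proof -
    have "(-27 :: int) ^ r = (-1) ^ r * 3 ^ (3 * r)"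
      by (simp add: power_mult flip: power_mult_distrib)
    moreover have "(-1 :: int) ^ r * (-1) ^ (3 * r - 1) = - 1"
    proof -
      have "(-1 :: int) ^ r * (-1) ^ (3 * r - 1) = (-1) ^ (4 * r - 1)"
        using r3 by (simp flip: power_add)
      also have "odd (4 * r - 1)" using r3 by simp
      then have "(-1 :: int) ^ (4 * r - 1) = -1" by simp
      finally show ?thesis .
    qed
    moreover have "(3 :: int) ^ (3 * r) * 3 ^ (p - 3 * r) = 3 ^ p"
      using r3 by (simp flip: power_add)
    moreover have "((-1) ^ r * 3 ^ (3 * r) * B) * (-1) ^ (3 * r - 1) * 3 ^ (p - 3 * r) =
       B * ((-1 :: int) ^ r * (-1) ^ (3 * r - 1)) * (3 ^ (3 * r) * 3 ^ (p - 3 * r))"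
      by (simp only: mult_ac)
    ultimately show ?thesis by simp
  qed
  also have "[- (B * 3 ^ p) = - (B * 3)] (mod int p)"
    using fermat_power_cong[OF p(1), of 3] by (intro cong_uminus cong_scalar_left) simp
  finally have "[(-1) ^ r * V * (trinom r * int ((p - 1) choose (3 * r - 1)) * 3 ^ (p - 3 * r)) =
      (-1) ^ r * V * - (B * 3)] (mod int p)"
    by (rule cong_scalar_left)
  then have E: "[int p * ((-1) ^ r * V * (trinom r * int ((p - 1) choose (3 * r - 1)) * 3 ^ (p - 3 * r))) =
      int p * ((-1) ^ r * V * - (B * 3))] (mod (int p)\<^sup>2)"
    by (rule prime_dvd_cong_power2) simp
  have "3 * ((-1) ^ r * trinom r * int (p choose (3 * r)) * 3 ^ (p - 3 * r)) =
      (-1) ^ r * trinom r * 3 ^ (p - 3 * r) * (3 * int (p choose (3 * r)))"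
    by (simp only: mult_ac)
  also have "[\<dots> = (-1) ^ r * trinom r * 3 ^ (p - 3 * r) *
      (int p * (int ((p - 1) choose (3 * r - 1)) * V))] (mod (int p)\<^sup>2)"
    by (rule cong_scalar_left) (rule C)
  also have "(-1) ^ r * trinom r * 3 ^ (p - 3 * r) * (int p * (int ((p - 1) choose (3 * r - 1)) * V)) =
      int p * ((-1) ^ r * V * (trinom r * int ((p - 1) choose (3 * r - 1)) * 3 ^ (p - 3 * r)))"
    by (simp only: mult_ac)
  also note E
  also have "int p * ((-1) ^ r * V * - (B * 3)) = 3 * (- int p * ((-1) ^ r * B * V))"
    by simp
  finally have "[3 * ((-1) ^ r * trinom r * int (p choose (3 * r)) * 3 ^ (p - 3 * r)) =
      3 * (- int p * ((-1) ^ r * B * V))] (mod (int p)\<^sup>2)" .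
  moreover have "\<not> p dvd 3"
    using p by (auto dest: dvd_imp_le)
  then have "coprime 3 ((int p)\<^sup>2)"
    using coprime_int_prime_power[OF p(1), of 3 2] by simp
  ultimately show ?thesis
    unfolding B_def V_def by (simp only: cong_mult_lcancel)
qed

text \<open>Both sides equal \<open>2 * p * H\<close> modulo \<open>p^2\<close>, one by the harmonic
  identity, the other by the Fermat quotient of 3.\<close>

lemma sum_trinom_cong:
  assumes p: "prime p" "p > 3"
  shows "[(\<Sum>r = 1..p div 3. (-1) ^ r * trinom r * int (p choose (3 * r)) * 3 ^ (p - 3 * r)) =
    3 - 3 ^ p] (mod (int p)\<^sup>2)"
proof -
  define m where "m = p div 3"
  define H where "H = (\<Sum>k = 1..m. prime_inverse p k)"
  have "[(\<Sum>r = 1..m. (-1) ^ r * trinom r * int (p choose (3 * r)) * 3 ^ (p - 3 * r)) =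
      (\<Sum>r = 1..m. - int p * ((-1) ^ r * (int (m choose r) * int ((m + r) choose r)) * prime_inverse p r))] (mod (int p)\<^sup>2)"
    using p by (intro cong_sum trinom_term_cong) (simp_all add: m_def)
  also have "(\<Sum>r = 1..m. - int p * ((-1) ^ r * (int (m choose r) * int ((m + r) choose r)) * prime_inverse p r)) =
      - int p * (\<Sum>r = 1..m. (-1) ^ r * (int (m choose r) * int ((m + r) choose r)) * prime_inverse p r)"
    by (simp only: sum_distrib_left)
  also have "[\<dots> = - int p * (- 2 * H)] (mod (int p)\<^sup>2)"
    unfolding H_def using p
    by (intro prime_dvd_cong_power2 sum_binomial_prime_inverse) (auto simp: m_def)
  also have "- int p * (- 2 * H) = 3 - (3 - 2 * int p * H)"
    by simp
  also have "[\<dots> = 3 - 3 ^ p] (mod (int p)\<^sup>2)"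
    using power_3_prime_cong[OF p] unfolding H_def m_def by (intro cong_diff cong_refl) (rule cong_sym)
  finally show ?thesis unfolding m_def .
qed

subsection \<open>The Almkvist--Zudilin numbers\<close>

text \<open>Next to a factor divisible by \<open>q\<close>, the cofactor need be known only modulo
  \<open>q\<close>.\<close>

lemma cong_mult_power2:
  fixes q :: int
  assumes "[x = x'] (mod q)" "[c = c'] (mod q\<^sup>2)" "q dvd c"
  shows "[x * c = x' * c'] (mod q\<^sup>2)"
proof -
  have "[c * x = c * x'] (mod q\<^sup>2)"
    using assms by (intro prime_dvd_cong_power2)
  also have "[c * x' = c' * x'] (mod q\<^sup>2)"
    by (rule cong_scalar_right) fact
  finally show ?thesis by (simp add: mult.commute)
qed

lemma lucas_cong_int:
  assumes "prime p" "c < p" "d < p"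
  shows "[int ((p * a + c) choose (p * b + d)) = int (a choose b) * int (c choose d)] (mod int p)"
  using lucas_cong[OF assms, of a b] by (metis cong_int_iff of_nat_mult)

text \<open>Since \<open>3 * r < p\<close>, tripling \<open>p * j + r\<close> produces no carry out
  of the last digit in base \<open>p\<close>.\<close>

lemma trinom_lucas_cong:
  assumes "prime p" "3 * r < p"
  shows "[trinom (p * j + r) = trinom j * trinom r] (mod int p)"
proof -
  have "[int ((p * (3 * j) + 3 * r) choose (p * j + r)) * int ((p * (2 * j) + 2 * r) choose (p * j + r)) =
      (int ((3 * j) choose j) * int ((3 * r) choose r)) * (int ((2 * j) choose j) * int ((2 * r) choose r))] (mod int p)"
    using assms by (intro cong_mult lucas_cong_int) auto
  then show ?thesis by (simp add: trinom_def algebra_simps)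
qed

text \<open>A carry occurs on doubling or tripling \<open>k = p * j + r\<close>: if
  \<open>2r < p\<close>, the last digit \<open>3r - p\<close> of \<open>3k\<close> is below
  \<open>r\<close> and kills \<open>C(3k,k)\<close>; otherwise \<open>2r - p\<close> is below
  \<open>r\<close> and kills \<open>C(2k,k)\<close>.\<close>

lemma prime_dvd_trinom:
  assumes p: "prime p" "p > 3" and r: "r < p" "p < 3 * r"
  shows "int p dvd trinom (p * j + r)"
proof (cases "2 * r < p")
  case True
  then have "[int ((p * (3 * j + 1) + (3 * r - p)) choose (p * j + r)) =
      int ((3 * j + 1) choose j) * int ((3 * r - p) choose r)] (mod int p)"
    using p r by (intro lucas_cong_int) auto
  moreover have "p * (3 * j + 1) + (3 * r - p) = 3 * (p * j + r)"
    using r by (simp add: algebra_simps)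
  ultimately have "[int ((3 * (p * j + r)) choose (p * j + r)) =
      int ((3 * j + 1) choose j) * int ((3 * r - p) choose r)] (mod int p)"
    by (simp only:)
  moreover have "3 * r - p < r" using True r by linarith
  ultimately have "int p dvd int ((3 * (p * j + r)) choose (p * j + r))"
    by (simp add: cong_0_iff binomial_eq_0)
  then show ?thesis by (simp add: trinom_def)
next
  case False
  have "p \<noteq> 2 * r" using p prime_odd_nat[of p] by auto
  with False r have "[int ((p * (2 * j + 1) + (2 * r - p)) choose (p * j + r)) =
      int ((2 * j + 1) choose j) * int ((2 * r - p) choose r)] (mod int p)"
    using p by (intro lucas_cong_int) auto
  moreover have "p * (2 * j + 1) + (2 * r - p) = 2 * (p * j + r)"
    using False by (simp add: algebra_simps)
  ultimately have "[int ((2 * (p * j + r)) choose (p * j + r)) =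
      int ((2 * j + 1) choose j) * int ((2 * r - p) choose r)] (mod int p)"
    by (simp only:)
  moreover have "2 * r - p < r" using r by simp
  ultimately have "int p dvd int ((2 * (p * j + r)) choose (p * j + r))"
    by (simp add: cong_0_iff binomial_eq_0)
  then show ?thesis by (simp add: trinom_def)
qed

text \<open>Binomial expansion to first order. At \<open>N = 0\<close> the truncated exponent is
  harmless, as its coefficient is 0.\<close>

lemma power_add_cong:
  fixes a q w :: int
  shows "[(a + q * w) ^ N = a ^ N + int N * a ^ (N - 1) * (q * w)] (mod q\<^sup>2)"
proof (induction N)
  case (Suc N)
  have "(a + q * w) ^ Suc N = (a + q * w) * (a + q * w) ^ N"
    by simp
  also have "[\<dots> = (a + q * w) * (a ^ N + int N * a ^ (N - 1) * (q * w))] (mod q\<^sup>2)"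
    by (rule cong_scalar_left) (rule Suc)
  also have "(a + q * w) * (a ^ N + int N * a ^ (N - 1) * (q * w)) =
      a ^ Suc N + int (Suc N) * a ^ N * (q * w) + q\<^sup>2 * (int N * a ^ (N - 1) * w\<^sup>2)"
    by (cases N) (simp_all add: algebra_simps power2_eq_square)
  also have "[\<dots> = a ^ Suc N + int (Suc N) * a ^ N * (q * w)] (mod q\<^sup>2)"
    by (simp add: cong_iff_dvd_diff)
  finally show ?case by simp
qed simp

definition az_term :: "nat \<Rightarrow> nat \<Rightarrow> int" where
  "az_term N k = (-1) ^ (N - k) * trinom k * int (N choose (3 * k)) * int ((N + k) choose k) * 3 ^ (N - 3 * k)"

lemma az_term_eq_0: "N < 3 * k \<Longrightarrow> az_term N k = 0"
  by (simp add: az_term_def binomial_eq_0)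

text \<open>Terms beyond \<open>N div 3\<close> vanish, so the bound can be chosen to fit blocks of
  length \<open>p\<close>.\<close>

lemma almkvist_zudilin_eq_sum:
  assumes "N < 3 * b"
  shows "almkvist_zudilin N = (\<Sum>k<b. az_term N k)"
proof -
  have "almkvist_zudilin N = (\<Sum>k = 0..N div 3. az_term N k)"
    by (simp add: almkvist_zudilin_def az_term_def trinom_def mult.assoc)
  also have "\<dots> = (\<Sum>k<b. az_term N k)"
    using assms by (intro sum.mono_neutral_left) (auto intro!: az_term_eq_0)
  finally show ?thesis .
qed

text \<open>Babbage reduces every binomial and oddness of \<open>p\<close> preserves the sign; the
  power of 3 is left as it is, to be corrected by the terms with \<open>r > 0\<close>.\<close>

lemma az_term_mult_cong:
  assumes p: "prime p" "p > 3" and "3 * j \<le> n"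
  shows "[az_term (p * n) (p * j) =
    (-1) ^ (n - j) * trinom j * int (n choose (3 * j)) * int ((n + j) choose j) * (3 ^ p) ^ (n - 3 * j)]
    (mod (int p)\<^sup>2)"
proof -
  have b: "[int ((p * a) choose (p * b)) = int (a choose b)] (mod (int p)\<^sup>2)" for a b
    using babbage_cong[OF p(1), of a b] by (metis cong_int_iff of_nat_power)
  have "odd p" using p prime_odd_nat by auto
  then have "(-1 :: int) ^ (p * n - p * j) = (-1) ^ (n - j)"
    by (simp add: power_mult flip: diff_mult_distrib2)
  moreover have "(3 :: int) ^ (p * n - 3 * (p * j)) = (3 ^ p) ^ (n - 3 * j)"
  proof -
    have "p * n - 3 * (p * j) = p * (n - 3 * j)" by (simp add: algebra_simps)
    then show ?thesis by (simp add: power_mult)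
  qed
  moreover have "[trinom (p * j) = trinom j] (mod (int p)\<^sup>2)"
    using cong_mult[OF b[of "3 * j" j] b[of "2 * j" j]] by (simp add: trinom_def algebra_simps)
  moreover have "[int ((p * n) choose (3 * (p * j))) = int (n choose (3 * j))] (mod (int p)\<^sup>2)"
    using b[of n "3 * j"] by (simp add: algebra_simps)
  moreover have "[int ((p * n + p * j) choose (p * j)) = int ((n + j) choose j)] (mod (int p)\<^sup>2)"
    using b[of "n + j" j] by (simp add: algebra_simps)
  ultimately show ?thesis
    unfolding az_term_def by (auto intro!: cong_mult)
qed

text \<open>\<open>C(p n, 3k)\<close> is divisible by \<open>p\<close> and is evaluated modulo
  \<open>p^2\<close>; for the other factors Lucas and Fermat modulo \<open>p\<close>
  suffice.\<close>

lemma az_term_offset_cong: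
  assumes p: "prime p" "p > 3" and r: "0 < r" "3 * r < p" and n: "3 * j \<le> n" "n > 0"
  shows "[az_term (p * n) (p * j + r) =
    (-1) ^ (n - j) * trinom j * int (n choose (3 * j)) * int ((n + j) choose j) *
      (int (n - 3 * j) * 3 ^ (n - 3 * j - 1) *
        ((-1) ^ r * trinom r * int (p choose (3 * r)) * 3 ^ (p - 3 * r)))] (mod (int p)\<^sup>2)"
proof (cases "n = 3 * j")
  \<comment> \<open>Here the index lies beyond the range, and on the right the factor
    \<open>n - 3 * j\<close> is 0.\<close>
  case True
  then have "p * n < 3 * (p * j + r)" using r by simp
  with True show ?thesis by (simp add: az_term_eq_0)
next
  case False
  then obtain N where N: "n = 3 * j + Suc N"
    using n by (metis Suc_diff_Suc add_diff_inverse_nat le_antisym linorder_not_less)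
  have eq3: "3 * (p * j + r) = p * (3 * j) + 3 * r" by simp
  have "odd p" using p prime_odd_nat by auto
  have sign: "(-1 :: int) ^ (p * n - (p * j + r)) = (-1) ^ (n - j) * (-1) ^ r"
  proof -
    have "p * (n - j) \<ge> r"
    proof -
      have "p * 1 \<le> p * (n - j)" using N by (intro mult_le_mono2) simp
      with r show ?thesis by linarith
    qed
    moreover have "p * n - (p * j + r) = p * (n - j) - r"
      by (simp add: diff_mult_distrib2)
    moreover from calculation have "p * (n - j) = (p * n - (p * j + r)) + r"
      by simp
    ultimately have "(-1 :: int) ^ (p * (n - j)) = (-1) ^ (p * n - (p * j + r)) * (-1) ^ r"
      by (metis power_add)
    moreover have "(-1 :: int) ^ (p * (n - j)) = (-1) ^ (n - j)"
      using \<open>odd p\<close> by (simp add: power_mult)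
    ultimately show ?thesis
      by (simp add: mult.assoc flip: power_mult_distrib)
  qed
  have tri: "[trinom (p * j + r) = trinom j * trinom r] (mod int p)"
    using p r by (intro trinom_lucas_cong) auto
  have bin: "[int ((p * n + (p * j + r)) choose (p * j + r)) = int ((n + j) choose j)] (mod int p)"
    using lucas_cong_int[of p r r "n + j" j] p r by (simp add: algebra_simps)
  have pow: "[3 ^ (p * n - 3 * (p * j + r)) = 3 ^ N * 3 ^ (p - 3 * r)] (mod int p)"
  proof -
    \<comment> \<open>Subtracting \<open>3 * r\<close> borrows one block of length \<open>p\<close>,
      hence \<open>N = n - 3 * j - 1\<close>.\<close>
    have "p * n - 3 * (p * j + r) = p * N + (p - 3 * r)"
      using r unfolding N by (simp add: algebra_simps)
    then have "(3 :: int) ^ (p * n - 3 * (p * j + r)) = (3 ^ p) ^ N * 3 ^ (p - 3 * r)"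
      by (simp add: power_add power_mult)
    also have "[\<dots> = 3 ^ N * 3 ^ (p - 3 * r)] (mod int p)"
      using fermat_power_cong[OF p(1), of 3] by (intro cong_mult cong_pow) auto
    finally show ?thesis .
  qed
  have "[(p * n) choose (p * (3 * j) + 3 * r) = (n - 3 * j) * (n choose (3 * j)) * (p choose (3 * r))] (mod p\<^sup>2)"
    using p r n by (intro binomial_mult_offset_cong) auto
  then have C: "[int ((p * n) choose (3 * (p * j + r))) =
      int (n - 3 * j) * int (n choose (3 * j)) * int (p choose (3 * r))] (mod (int p)\<^sup>2)"
    unfolding eq3 by (metis cong_int_iff of_nat_mult of_nat_power)
  have dvd: "int p dvd int ((p * n) choose (3 * (p * j + r)))"
    unfolding eq3 of_nat_dvd_iff using p r by (intro prime_dvd_binomial_mult) auto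
  have "az_term (p * n) (p * j + r) =
      ((-1) ^ (n - j) * (-1) ^ r * trinom (p * j + r) * int ((p * n + (p * j + r)) choose (p * j + r)) *
        3 ^ (p * n - 3 * (p * j + r))) * int ((p * n) choose (3 * (p * j + r)))"
    unfolding az_term_def sign by (simp only: mult_ac)
  also have "[\<dots> = ((-1) ^ (n - j) * (-1) ^ r * (trinom j * trinom r) * int ((n + j) choose j) *
        (3 ^ N * 3 ^ (p - 3 * r))) *
        (int (n - 3 * j) * int (n choose (3 * j)) * int (p choose (3 * r)))] (mod (int p)\<^sup>2)"
    by (intro cong_mult_power2 C dvd cong_mult tri bin pow cong_refl)
  finally show ?thesis
    using N by (simp add: mult_ac)
qed

text \<open>One factor \<open>p\<close> comes from the carry in \<open>trinom\<close>, the other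
  from \<open>C(p n, 3k)\<close>, because \<open>3k\<close> is not a multiple of
  \<open>p\<close>.\<close>

lemma az_term_offset_dvd:
  assumes p: "prime p" "p > 3" and r: "r < p" "p < 3 * r"
  shows "(int p)\<^sup>2 dvd az_term (p * n) (p * j + r)"
proof -
  have "p * (3 * j + 3 * r div p) + 3 * r mod p = 3 * (p * j + r)"
    by (simp add: algebra_simps)
  moreover have "0 < 3 * r mod p"
  proof -
    have "\<not> p dvd 3" "\<not> p dvd r" using p r by (auto dest: dvd_imp_le)
    then have "\<not> p dvd 3 * r" using p by (simp add: prime_dvd_mult_iff)
    then show ?thesis by (simp add: mod_greater_zero_iff_not_dvd)
  qed
  then have "p dvd ((p * n) choose (p * (3 * j + 3 * r div p) + 3 * r mod p))"
    using p by (intro prime_dvd_binomial_mult) auto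
  ultimately have "int p dvd int ((p * n) choose (3 * (p * j + r)))"
    by simp
  then have "int p * int p dvd trinom (p * j + r) * int ((p * n) choose (3 * (p * j + r)))"
    by (intro mult_dvd_mono prime_dvd_trinom p r)
  then show ?thesis
    unfolding az_term_def power2_eq_square
    by (metis (no_types, lifting) dvd_mult dvd_mult2 mult.assoc)
qed

text \<open>The offset terms add up to \<open>T * N * 3^(N-1) * (3 - 3^p)\<close>, which cancels the
  first-order error of replacing \<open>(3^p)^N\<close> by \<open>3^N\<close> in the term
  \<open>r = 0\<close>.\<close>

lemma sum_az_term_cong:
  assumes p: "prime p" "p > 3" and n: "n > 0"
  shows "[(\<Sum>r<p. az_term (p * n) (p * j + r)) = az_term n j] (mod (int p)\<^sup>2)"
proof (cases "3 * j \<le> n")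
  case False
  have "p * n < 3 * (p * j + r)" for r
  proof -
    have "p * n < p * (3 * j)" using False p by simp
    also have "\<dots> \<le> 3 * (p * j + r)" by simp
    finally show ?thesis .
  qed
  then show ?thesis using False by (simp add: az_term_eq_0)
next
  case True
  define m where "m = p div 3"
  define N where "N = n - 3 * j"
  define T where "T = (-1) ^ (n - j) * trinom j * int (n choose (3 * j)) * int ((n + j) choose j)"
  define s where "s r = (-1) ^ r * trinom r * int (p choose (3 * r)) * 3 ^ (p - 3 * r)" for r
  define f where "f r = (if r = 0 then T * (3 ^ p) ^ N else if r \<in> {1..m} then T * (int N * 3 ^ (N - 1) * s r) else 0)" for r
  have m: "3 * m < p" "p < 3 * m + 3"
    using prime_div_3[OF p] unfolding m_def by linarith+
  have "[az_term (p * n) (p * j + r) = f r] (mod (int p)\<^sup>2)" if r: "r < p" for r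
  proof -
    consider "r = 0" | "r \<in> {1..m}" | "m < r" by fastforce
    then show ?thesis
    proof cases
      case 1
      then show ?thesis
        using az_term_mult_cong[OF p True] by (simp add: f_def T_def N_def)
    next
      case 2
      then have "0 < r" "3 * r < p" using m by auto
      then show ?thesis
        using az_term_offset_cong[OF p _ _ True n, of r] 2 by (simp add: f_def T_def N_def s_def)
    next
      case 3
      then show ?thesis
        using az_term_offset_dvd[OF p r, of n j] m by (simp add: f_def cong_0_iff)
    qed
  qed
  then have "[(\<Sum>r<p. az_term (p * n) (p * j + r)) = (\<Sum>r<p. f r)] (mod (int p)\<^sup>2)"
    by (intro cong_sum) simp
  also have "(\<Sum>r<p. f r) = (\<Sum>r\<in>insert 0 {1..m}. f r)"
    using m by (intro sum.mono_neutral_right) (auto simp: f_def)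
  also have "\<dots> = T * ((3 ^ p) ^ N + int N * 3 ^ (N - 1) * (\<Sum>r = 1..m. s r))"
    by (simp add: f_def distrib_left mult.assoc sum_distrib_left)
  also have "[\<dots> = T * ((3 ^ p) ^ N + int N * 3 ^ (N - 1) * (3 - 3 ^ p))] (mod (int p)\<^sup>2)"
    unfolding s_def m_def using p by (intro cong_scalar_left cong_add cong_refl sum_trinom_cong)
  also have "[T * ((3 ^ p) ^ N + int N * 3 ^ (N - 1) * (3 - 3 ^ p)) = T * 3 ^ N] (mod (int p)\<^sup>2)"
  proof (rule cong_scalar_left)
    have "[3 = 3 ^ p] (mod int p)"
      using fermat_power_cong[OF p(1), of 3] by (simp add: cong_sym_eq)
    \<comment> \<open>\<open>w\<close> is three times the Fermat quotient of 3.\<close>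
    then obtain w where w: "3 ^ p = 3 + int p * w"
      by (auto simp: cong_iff_lin)
    have "[(3 + int p * w) ^ N + int N * 3 ^ (N - 1) * (3 - 3 ^ p) =
        3 ^ N + int N * 3 ^ (N - 1) * (int p * w) + int N * 3 ^ (N - 1) * (3 - 3 ^ p)] (mod (int p)\<^sup>2)"
      by (intro cong_add power_add_cong cong_refl)
    then show "[(3 ^ p) ^ N + int N * 3 ^ (N - 1) * (3 - 3 ^ p) = 3 ^ N] (mod (int p)\<^sup>2)"
      unfolding w by simp
  qed
  also have "T * 3 ^ N = az_term n j"
    by (simp add: T_def N_def az_term_def)
  finally show ?thesis .
qed

theorem theorem4p1:
  fixes p n :: nat
  assumes "prime p" and "p \<ge> 5" and "n > 0"
  shows "[almkvist_zudilin (p * n) = almkvist_zudilin n] (mod (int p)\<^sup>2)"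
proof -
  \<comment> \<open>The generous bound gives \<open>Suc n\<close> full blocks of length
    \<open>p\<close>, one for each \<open>j < Suc n\<close> in the sum for \<open>n\<close>.\<close>
  have "almkvist_zudilin (p * n) = (\<Sum>k < Suc n * p. az_term (p * n) k)"
    using assms by (intro almkvist_zudilin_eq_sum) simp
  also have "\<dots> = (\<Sum>j < Suc n. \<Sum>r<p. az_term (p * n) (p * j + r))"
    unfolding sum.nat_group[symmetric]
  proof (rule sum.cong[OF refl])
    fix j
    show "(\<Sum>k = j * p..<j * p + p. az_term (p * n) k) = (\<Sum>r<p. az_term (p * n) (p * j + r))"
      by (rule sum.reindex_bij_witness[of _ "\<lambda>r. p * j + r" "\<lambda>k. k - p * j"]) (auto simp: mult.commute)
  qed
  also have "[\<dots> = (\<Sum>j < Suc n. az_term n j)] (mod (int p)\<^sup>2)"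
    using assms by (intro cong_sum sum_az_term_cong) auto
  also have "(\<Sum>j < Suc n. az_term n j) = almkvist_zudilin n"
    by (intro almkvist_zudilin_eq_sum[symmetric]) simp
  finally show ?thesis .
qed

end
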